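(* Let $\Gamma,\varepsilon,c,a>0$, let $\theta\in\mathbb{R}$, and let $\varphi:\mathbb{R}\to\mathbb{R}$ be a smooth function. Consider the disturbance-free closed-loop system with state $(y,z)\in\mathbb{R}^2$: $$\dot y=\theta y\varphi(y)-\frac{c}{2}y-\frac{1+e^{z}}{2}\left(\frac{1+\varphi^2(y)y^2}{2a}+c+\frac{\varphi^2(y)}{c}\right)y,\qquad \dot z=\Gamma e^{-z}\left(\frac12y^2-\varepsilon\right)^{+},$$ with output $\tilde y=\left(|y|-\sqrt{2\varepsilon}\right)^{+}$. If there exists $r>0$ such that $$\theta\varphi(y)\le c+\frac{1+\varphi^2(y)y^2}{4a}+\frac{\varphi^2(y)}{2c}\qquad\text{for all } y\in\mathbb{R}\text{ with }|y|\in\left[\sqrt{2\varepsilon},\sqrt{2(\varepsilon+r)}\right],$$ then this system with output $\tilde y$ satisfies the UGAOS property.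
   Context: Notation: $(s)^{+}:=\max\{0,s\}$ for $s\in\mathbb{R}$. The system arises from the plant $\dot y=\theta y\varphi(y)+u+d$ with $d\equiv0$, in closed loop with the adaptive feedback $u=-\frac c2y-\frac{1+e^z}{2}\left(\frac{1+\varphi^2(y)y^2}{2a}+c+\frac{\varphi^2(y)}{c}\right)y$, $\dot z=\Gamma e^{-z}\left(\frac12y^2-\varepsilon\right)^+$. This system is forward complete (solutions exist for all $t\ge0$ from every initial state). UGAOS (uniform global asymptotic output stability) of a forward complete input-free system with state $x\in\mathbb{R}^n$ and output trajectory $t\mapsto\tilde y(t,x_0)$ from initial state $x_0$ means that all of the following hold: - (Lagrange output stability) for every $\delta>0$ there is $\eta>0$ such that $|\tilde y(t,x_0)|\le\eta$ for all $t\ge0$ whenever $|x_0|\le\delta$; - (Lyapunov output stability) for every $\eta>0$ there is $\delta>0$ such that $|\tilde y(t,x_0)|\le\eta$ for all $t\ge0$ whenever $|x_0|\le\delta$; - (uniform global output attractivity) for every $\eta,R>0$ there is $T>0$ such that $|\tilde y(t,x_0)|\le\eta$ for all $t\ge T$ whenever $|x_0|\le R$. Here $x=(y,z)$, $n=2$, and the bounds may depend on $\theta,\varphi,\Gamma,\varepsilon,c,a$. *)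

theory Defs
  imports "HOL-Analysis.Analysis"
begin

definition smooth_fun :: "(real \<Rightarrow> real) \<Rightarrow> bool" where
  "smooth_fun \<phi> \<longleftrightarrow> (\<forall>k x. (deriv ^^ k) \<phi> field_differentiable at x)"

text \<open>Solutions on \<open>[0, \<infinity>)\<close> of the autonomous system \<open>x' = f x\<close>; the derivative at
  \<open>0\<close> is one-sided, and the values of \<open>x\<close> at negative times are irrelevant.\<close>

definition forward_solution :: "('a::euclidean_space \<Rightarrow> 'a) \<Rightarrow> 'a \<Rightarrow> (real \<Rightarrow> 'a) \<Rightarrow> bool" where
  "forward_solution f x0 x \<longleftrightarrow>
     x 0 = x0 \<and> (\<forall>t\<ge>0. (x has_vector_derivative f (x t)) (at t within {0..}))"

definition forward_complete :: "('a::euclidean_space \<Rightarrow> 'a) \<Rightarrow> bool" where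
  "forward_complete f \<longleftrightarrow> (\<forall>x0. \<exists>x. forward_solution f x0 x)"

text \<open>In the following, \<open>f\<close> is the vector field and \<open>h\<close> the output map, so that the output
  trajectory of a solution \<open>x\<close> is \<open>\<lambda>t. h (x t)\<close>.\<close>

definition lagrange_output_stable ::
    "('a::euclidean_space \<Rightarrow> 'a) \<Rightarrow> ('a \<Rightarrow> 'b::real_normed_vector) \<Rightarrow> bool" where
  "lagrange_output_stable f h \<longleftrightarrow>
     (\<forall>\<delta>>0. \<exists>\<eta>>0. \<forall>x0 x. norm x0 \<le> \<delta> \<longrightarrow> forward_solution f x0 x \<longrightarrow>
        (\<forall>t\<ge>0. norm (h (x t)) \<le> \<eta>))"

definition lyapunov_output_stable ::
    "('a::euclidean_space \<Rightarrow> 'a) \<Rightarrow> ('a \<Rightarrow> 'b::real_normed_vector) \<Rightarrow> bool" where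
  "lyapunov_output_stable f h \<longleftrightarrow>
     (\<forall>\<eta>>0. \<exists>\<delta>>0. \<forall>x0 x. norm x0 \<le> \<delta> \<longrightarrow> forward_solution f x0 x \<longrightarrow>
        (\<forall>t\<ge>0. norm (h (x t)) \<le> \<eta>))"

definition uniformly_globally_output_attractive ::
    "('a::euclidean_space \<Rightarrow> 'a) \<Rightarrow> ('a \<Rightarrow> 'b::real_normed_vector) \<Rightarrow> bool" where
  "uniformly_globally_output_attractive f h \<longleftrightarrow>
     (\<forall>\<eta>>0. \<forall>R>0. \<exists>T>0. \<forall>x0 x. norm x0 \<le> R \<longrightarrow> forward_solution f x0 x \<longrightarrow>
        (\<forall>t\<ge>T. norm (h (x t)) \<le> \<eta>))"

text \<open>The three stability properties quantify over all solutions on \<open>[0, \<infinity>)\<close>; without forward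
  completeness they could hold vacuously.\<close>

definition UGAOS ::
    "('a::euclidean_space \<Rightarrow> 'a) \<Rightarrow> ('a \<Rightarrow> 'b::real_normed_vector) \<Rightarrow> bool" where
  "UGAOS f h \<longleftrightarrow>
     forward_complete f \<and> lagrange_output_stable f h \<and> lyapunov_output_stable f h \<and>
     uniformly_globally_output_attractive f h"

text \<open>The state \<open>(y, z)\<close> lives in \<^typ>\<open>real \<times> real\<close>, whose norm is the Euclidean one.\<close>

definition closed_loop ::
    "real \<Rightarrow> (real \<Rightarrow> real) \<Rightarrow> real \<Rightarrow> real \<Rightarrow> real \<Rightarrow> real \<Rightarrow> real \<times> real \<Rightarrow> real \<times> real" where
  "closed_loop \<theta> \<phi> \<Gamma> \<epsilon> c a = (\<lambda>(y, z).
     (\<theta> * y * \<phi> y - c / 2 * y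
        - (1 + exp z) / 2 * ((1 + (\<phi> y)\<^sup>2 * y\<^sup>2) / (2 * a) + c + (\<phi> y)\<^sup>2 / c) * y,
      \<Gamma> * exp (- z) * max 0 (y\<^sup>2 / 2 - \<epsilon>)))"

definition deadzone_output :: "real \<Rightarrow> real \<times> real \<Rightarrow> real" where
  "deadzone_output \<epsilon> = (\<lambda>(y, z). max 0 (\<bar>y\<bar> - sqrt (2 * \<epsilon>)))"

end

theory Submission
  imports Defs
begin

text \<open>
  Put \<open>V = y\<^sup>2 / 2\<close> and \<open>w = exp z\<close>. Then \<open>w' = \<Gamma> (V - \<epsilon>)\<^sup>+\<close>, and Young's inequality
  \<open>\<theta> \<phi> \<le> \<phi>\<^sup>2 / (2 c) + c \<theta>\<^sup>2 / 2\<close> gives \<open>V' \<le> c (\<theta>\<^sup>2 - 2 - w) V\<close> everywhere, while the hypothesis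
  gives \<open>V' \<le> - c w V\<close> for \<open>\<epsilon> \<le> V \<le> \<epsilon> + r\<close>. Hence every sublevel set \<open>V \<le> k\<close> with
  \<open>\<epsilon> \<le> k < \<epsilon> + r\<close> is forward invariant, which for \<open>k = \<epsilon>\<close> is Lyapunov output stability. While
  \<open>V > \<epsilon>\<close>, any growth of \<open>V\<close> is controlled by the growth of the adaptation variable \<open>w\<close>, which
  bounds \<open>V\<close> uniformly on bounded sets of initial states. As long as \<open>V > \<epsilon> + r / 2\<close>, \<open>w\<close> grows
  at least linearly, so after a uniform time \<open>V\<close> decreases at a uniform rate and reaches
  \<open>\<epsilon>\<close>: the output even vanishes in finite time. The resulting bounds on \<open>(y, z)\<close> are uniform in
  time, so global existence follows from the globally Lipschitz case by truncating the vector field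
  outside a rectangle.
\<close>

subsection \<open>Global existence of solutions\<close>

text \<open>Differentiability is local: near \<open>t\<close> the half-line agrees with
  \<open>{0..t + 1}\<close>, where the fundamental theorem of calculus applies.\<close>

lemma indefinite_integral_has_vector_derivative_atLeast:
  fixes g :: "real \<Rightarrow> 'a::banach"
  assumes "continuous_on {0..} g" and "0 \<le> t"
  shows "((\<lambda>t. integral {0..t} g) has_vector_derivative g t) (at t within {0..})"
proof -
  have "((\<lambda>t. integral {0..t} g) has_vector_derivative g t) (at t within {0..t + 1})"
    using assms by (intro integral_has_vector_derivative continuous_on_subset[OF assms(1)]) auto
  moreover have "at t within {0..t + 1} = at t within {0..}"
    by (rule at_within_nhd[of t "{..<t + 1}"]) auto
  ultimately show ?thesis by simp
qed

text \<open>Integrating \<open>exp (K * s)\<close> gains the factor \<open>1 / K\<close>, which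
  later turns the Lipschitz constant \<open>L\<close> into the contraction constant
  \<open>L / K\<close>.\<close>

lemma norm_weighted_integral_le:
  fixes g :: "real \<Rightarrow> 'a::banach"
  assumes "continuous_on {0..} g" and "0 \<le> t" and "0 < K" and "0 \<le> C"
    and bound: "\<And>s. 0 \<le> s \<Longrightarrow> norm (g s) \<le> C * exp (K * s)"
  shows "norm (exp (- (K * t)) *\<^sub>R integral {0..t} g) \<le> C / K"
proof -
  have "((\<lambda>s. C * exp (K * s)) has_integral C / K * exp (K * t) - C / K * exp (K * 0)) {0..t}"
    using assms by (intro fundamental_theorem_of_calculus)
      (auto intro!: derivative_eq_intros simp: has_real_derivative_iff_has_vector_derivative[symmetric])
  moreover have "g integrable_on {0..t}"
    using assms by (intro integrable_continuous_real continuous_on_subset[OF assms(1)]) auto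
  ultimately have "norm (integral {0..t} g) \<le> C / K * exp (K * t) - C / K"
    using bound integral_norm_bound_integral[of g "{0..t}" "\<lambda>s. C * exp (K * s)"]
    by (auto simp: has_integral_iff)
  also have "\<dots> \<le> C / K * exp (K * t)"
    using assms by simp
  finally show ?thesis
    by (simp add: exp_minus field_simps)
qed

text \<open>Picard's operator is a contraction for the weighted supremum norm
  \<open>sup exp (- K t) |x t - x0|\<close> on the whole half-line as soon as \<open>K > L\<close>; no gluing of local
  solutions is needed.\<close>

lemma forward_complete_lipschitz:
  fixes f :: "'a::euclidean_space \<Rightarrow> 'a"
  assumes "L-lipschitz_on UNIV f"
  shows "forward_complete f"
  unfolding forward_complete_def
proof
  fix x0 :: 'a
  have L: "0 \<le> L" using assms by (rule lipschitz_on_nonneg)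
  have f_diff: "norm (f p - f q) \<le> L * norm (p - q)" for p q
    using lipschitz_onD[OF assms, of p q] by (simp add: dist_norm)
  have f_cont: "continuous_on UNIV f" by (rule lipschitz_on_continuous_on[OF assms])
  define K where "K = 2 * L + 1"
  have K: "0 < K" "L / K \<le> 1 / 2" using L by (auto simp: K_def field_simps)
  \<comment> \<open>Here \<open>u\<close> stands for the deviation \<open>x - x0\<close> scaled by
    \<open>exp (- (K * s))\<close>, so the weighted norm becomes the plain supremum norm.\<close>
  define g where "g u s = f (x0 + exp (K * s) *\<^sub>R apply_bcontfun u s)" for u :: "real \<Rightarrow>\<^sub>C 'a" and s
  \<comment> \<open>Elements of the function space live on the whole line; \<open>max 0 t\<close>
    extends the operator to negative times by its value at 0.\<close>
  define G where "G u t = exp (- (K * max 0 t)) *\<^sub>R integral {0..max 0 t} (g u)" for u t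
  have g_cont: "continuous_on S (g u)" for u S
    unfolding g_def
    by (intro continuous_on_compose2[OF f_cont] continuous_intros) auto
  have exp_ge: "1 \<le> exp (K * s)" if "0 \<le> s" for s :: real
    using that K by simp
  have G_bound: "norm (G u t) \<le> (norm (f x0) + L * norm u) / K" for u t
    unfolding G_def
  proof (rule norm_weighted_integral_le)
    fix s :: real assume s: "0 \<le> s"
    have "norm (g u s) \<le> norm (f x0) + norm (g u s - f x0)"
      by (rule norm_triangle_sub)
    also have "norm (g u s - f x0) \<le> L * (exp (K * s) * norm (apply_bcontfun u s))"
      using f_diff[of "x0 + exp (K * s) *\<^sub>R apply_bcontfun u s" x0] by (simp add: g_def)
    also have "\<dots> \<le> L * (exp (K * s) * norm u)"
      using L by (intro mult_left_mono norm_bounded) auto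
    also have "norm (f x0) \<le> norm (f x0) * exp (K * s)"
      using mult_left_mono[OF exp_ge[OF s], of "norm (f x0)"] by simp
    finally show "norm (g u s) \<le> (norm (f x0) + L * norm u) * exp (K * s)"
      by (simp add: algebra_simps)
  qed (use g_cont K L in auto)
  have int_cont: "continuous_on {0..} (\<lambda>t. integral {0..t} (g u))" for u
    by (rule continuous_on_vector_derivative)
      (use indefinite_integral_has_vector_derivative_atLeast[OF g_cont] in auto)
  have G_cont: "continuous_on UNIV (G u)" for u
    unfolding G_def by (intro continuous_intros continuous_on_compose2[OF int_cont]) auto
  have G_bcontfun: "G u \<in> bcontfun" for u
    using G_cont G_bound by (auto simp: bcontfun_def bounded_iff)
  have G_contr: "dist (G u t) (G v t) \<le> L / K * dist u v" for u v t
  proof -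
    have "G u t - G v t = exp (- (K * max 0 t)) *\<^sub>R integral {0..max 0 t} (\<lambda>s. g u s - g v s)"
      unfolding G_def
      by (subst integral_diff)
        (auto simp: scaleR_diff_right intro!: integrable_continuous_real g_cont)
    also have "norm \<dots> \<le> (L * dist u v) / K"
    proof (rule norm_weighted_integral_le)
      fix s :: real
      have "norm (g u s - g v s)
          \<le> L * norm (exp (K * s) *\<^sub>R (apply_bcontfun u s - apply_bcontfun v s))"
        using f_diff[of "x0 + exp (K * s) *\<^sub>R apply_bcontfun u s" "x0 + exp (K * s) *\<^sub>R apply_bcontfun v s"]
        by (simp add: g_def scaleR_diff_right)
      also have "\<dots> = L * (exp (K * s) * dist (apply_bcontfun u s) (apply_bcontfun v s))"
        by (simp add: dist_norm)
      also have "\<dots> \<le> L * (exp (K * s) * dist u v)"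
        using L by (intro mult_left_mono dist_bounded) auto
      finally show "norm (g u s - g v s) \<le> L * dist u v * exp (K * s)"
        by (simp add: algebra_simps)
    qed (use g_cont K L in \<open>auto intro!: continuous_intros\<close>)
    finally show ?thesis by (simp add: dist_norm)
  qed
  have "\<exists>!u. Bcontfun (G u) = u"
  proof (rule banach_fix_type[of "1 / 2"])
    show "\<forall>u v. dist (Bcontfun (G u)) (Bcontfun (G v)) \<le> 1 / 2 * dist u v"
    proof (intro allI dist_bound)
      fix u v t
      show "dist (apply_bcontfun (Bcontfun (G u)) t) (apply_bcontfun (Bcontfun (G v)) t)
          \<le> 1 / 2 * dist u v"
        using order_trans[OF G_contr mult_right_mono[OF K(2)], of u v t]
        by (simp add: Bcontfun_inverse G_bcontfun)
    qed
  qed auto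
  then obtain u where "Bcontfun (G u) = u" by blast
  then have u: "apply_bcontfun u t = G u t" for t
    by (metis Bcontfun_inverse G_bcontfun)
  define x where "x t = x0 + integral {0..t} (g u)" for t
  have x: "f (x t) = g u t" if "0 \<le> t" for t
    using that by (simp add: x_def g_def[of u t] u G_def flip: exp_add)
  have "forward_solution f x0 x"
    unfolding forward_solution_def
  proof (intro conjI allI impI)
    fix t :: real assume "0 \<le> t"
    then show "(x has_vector_derivative f (x t)) (at t within {0..})"
      unfolding x[OF \<open>0 \<le> t\<close>] unfolding x_def
      using has_vector_derivative_add[OF has_vector_derivative_const
        indefinite_integral_has_vector_derivative_atLeast[OF g_cont \<open>0 \<le> t\<close>]] by simp
  qed (simp add: x_def)
  then show "\<exists>x. forward_solution f x0 x" by blast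
qed

text \<open>Projecting onto \<open>K\<close> first makes the field globally Lipschitz and leaves it
  unchanged on \<open>K\<close>. The solution obtained solves the original system up to its first
  exit from the interior, and \<open>confined\<close> rules that exit out.\<close>

lemma forward_solution_exists_confined:
  fixes f :: "'a::euclidean_space \<Rightarrow> 'a"
  assumes "L-lipschitz_on K f" and "compact K" "convex K" and "x0 \<in> interior K"
    and confined: "\<And>x \<tau>. 0 \<le> \<tau> \<Longrightarrow> x 0 = x0 \<Longrightarrow>
      (\<And>t. t \<in> {0..\<tau>} \<Longrightarrow> (x has_vector_derivative f (x t)) (at t within {0..\<tau>})) \<Longrightarrow>
      x \<tau> \<in> interior K"
  shows "\<exists>x. forward_solution f x0 x"
proof -
  have K: "closed K" "K \<noteq> {}"
    using assms(2,4) interior_subset by (auto simp: compact_imp_closed)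
  define F where "F = f \<circ> closest_point K"
  have "1-lipschitz_on UNIV (closest_point K)"
    using closest_point_lipschitz[OF \<open>convex K\<close> K] by (auto intro: lipschitz_onI)
  then have "(L * 1)-lipschitz_on UNIV F"
    unfolding F_def
    using assms(1) K by (intro lipschitz_on_compose lipschitz_on_subset[OF assms(1)])
      (auto intro: closest_point_in_set[OF K])
  then obtain x where x: "forward_solution F x0 x"
    using forward_complete_lipschitz unfolding forward_complete_def by blast
  have F: "F p = f p" if "p \<in> K" for p
    using that by (simp add: F_def closest_point_self)
  have der: "(x has_vector_derivative F (x t)) (at t within S)" if "0 \<le> t" "S \<subseteq> {0..}" for t S
    using x that unfolding forward_solution_def by (meson has_vector_derivative_within_subset)
  have x_0: "x 0 = x0" using x by (simp add: forward_solution_def)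
  have cont: "continuous_on S x" if "S \<subseteq> {0..}" for S
    using der that by (intro continuous_on_vector_derivative[where f' = "\<lambda>t. F (x t)"]) auto
  have stays: "x t \<in> interior K" if "0 \<le> t" for t
  proof (rule ccontr)
    assume "x t \<notin> interior K"
    have "closed {s \<in> {0..t}. x s \<in> - interior K}"
      by (intro continuous_closed_preimage[unfolded vimage_def Int_def mem_Collect_eq] cont) auto
    then have "compact {s \<in> {0..t}. x s \<in> - interior K}"
      by (auto simp: compact_eq_bounded_closed intro: bounded_subset[OF bounded_closed_interval])
    moreover have "t \<in> {s \<in> {0..t}. x s \<in> - interior K}"
      using that \<open>x t \<notin> interior K\<close> by simp
    ultimately obtain s where s: "s \<in> {0..t}" "x s \<notin> interior K"
      and least: "\<And>u. u \<in> {0..t} \<Longrightarrow> x u \<notin> interior K \<Longrightarrow> s \<le> u"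
      using compact_attains_inf[of "{s \<in> {0..t}. x s \<in> - interior K}"] by auto
    have "s \<noteq> 0" using s x_0 assms(4) by auto
    \<comment> \<open>By continuity the trajectory is still in the closed set \<open>K\<close> at
      the exit time \<open>s\<close>, so it solves the original equation on all of
      \<open>{0..s}\<close>.\<close>
    then have closure: "closure {0..<s} = {0..s}" using s by simp
    have "x u \<in> interior K" if "u \<in> {0..<s}" for u
      using least[of u] s that by force
    then have "x ` {0..<s} \<subseteq> K"
      using interior_subset by blast
    then have "x ` closure {0..<s} \<subseteq> K"
      unfolding closure using K
      by (intro image_closure_subset[of "{0..<s}", unfolded closure] cont) auto
    then have "x u \<in> K" if "u \<in> {0..s}" for u
      using that unfolding closure by blast
    then have "x s \<in> interior K"
      using s x_0 der by (intro confined) (auto simp flip: F)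
    with s show False by simp
  qed
  have "forward_solution f x0 x"
    unfolding forward_solution_def
    using stays der F interior_subset[of K] x_0 by (metis order_refl subsetD)
  then show ?thesis by blast
qed

subsection \<open>Lipschitz bounds on compact sets\<close>

lemma lipschitz_on_Pair:
  assumes "L-lipschitz_on S f" and "M-lipschitz_on S g"
  shows "(L + M)-lipschitz_on S (\<lambda>p. (f p, g p))"
proof (rule lipschitz_onI)
  fix p q assume pq: "p \<in> S" "q \<in> S"
  have "dist (f p, g p) (f q, g q) \<le> dist (f p) (f q) + dist (g p) (g q)"
    by (simp add: dist_Pair_Pair sqrt_sum_squares_le_sum)
  also have "\<dots> \<le> (L + M) * dist p q"
    using lipschitz_onD[OF assms(1) pq] lipschitz_onD[OF assms(2) pq] by (simp add: algebra_simps)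
  finally show "dist (f p, g p) (f q, g q) \<le> (L + M) * dist p q" .
qed (use assms in \<open>auto intro: add_nonneg_nonneg lipschitz_on_nonneg\<close>)

text \<open>Compactness bounds both factors. The existential form lets such rules chain backwards
  without naming constants.\<close>

lemma lipschitz_compact_mult:
  fixes f g :: "'a::metric_space \<Rightarrow> real"
  assumes "compact S" and "\<exists>L. L-lipschitz_on S f" and "\<exists>L. L-lipschitz_on S g"
  shows "\<exists>L. L-lipschitz_on S (\<lambda>x. f x * g x)"
proof -
  obtain Lf Lg where Lf: "Lf-lipschitz_on S f" and Lg: "Lg-lipschitz_on S g"
    using assms by blast
  have "bounded (f ` S)" "bounded (g ` S)"
    using assms(1) Lf Lg
    by (auto intro!: compact_imp_bounded compact_continuous_image lipschitz_on_continuous_on)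
  then obtain Bf Bg where Bf: "0 < Bf" "\<And>p. p \<in> S \<Longrightarrow> \<bar>f p\<bar> \<le> Bf" and Bg: "0 < Bg" "\<And>p. p \<in> S \<Longrightarrow> \<bar>g p\<bar> \<le> Bg"
    by (auto simp: bounded_pos)
  have "(Bf * Lg + Bg * Lf)-lipschitz_on S (\<lambda>x. f x * g x)"
  proof (rule lipschitz_onI)
    fix p q assume pq: "p \<in> S" "q \<in> S"
    have "\<bar>f p * g p - f q * g q\<bar> = \<bar>f p * (g p - g q) + g q * (f p - f q)\<bar>"
      by (simp add: algebra_simps)
    also have "\<dots> \<le> \<bar>f p\<bar> * \<bar>g p - g q\<bar> + \<bar>g q\<bar> * \<bar>f p - f q\<bar>"
      using abs_triangle_ineq by (simp flip: abs_mult)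
    also have "\<dots> \<le> Bf * (Lg * dist p q) + Bg * (Lf * dist p q)"
      using pq Bf Bg lipschitz_onD[OF Lf pq] lipschitz_onD[OF Lg pq]
      by (intro add_mono mult_mono) (auto simp: dist_real_def)
    finally show "dist (f p * g p) (f q * g q) \<le> (Bf * Lg + Bg * Lf) * dist p q"
      by (simp add: dist_real_def algebra_simps)
  qed (use Bf Bg lipschitz_on_nonneg[OF Lf] lipschitz_on_nonneg[OF Lg] in auto)
  then show ?thesis ..
qed

lemma lipschitz_ex_add:
  fixes f g :: "'a::metric_space \<Rightarrow> real"
  assumes "\<exists>L. L-lipschitz_on S f" and "\<exists>L. L-lipschitz_on S g"
  shows "\<exists>L. L-lipschitz_on S (\<lambda>x. f x + g x)"
  using assms lipschitz_on_add by blast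

text \<open>The range of \<open>g\<close> lies in a bounded interval, on which the continuous
  derivative \<open>h'\<close> is bounded.\<close>

lemma lipschitz_compact_C1:
  fixes h :: "real \<Rightarrow> real"
  assumes "compact S" and "\<exists>L. L-lipschitz_on S g"
    and "\<And>x. (h has_real_derivative h' x) (at x)" and "continuous_on UNIV h'"
  shows "\<exists>L. L-lipschitz_on S (\<lambda>x. h (g x))"
proof -
  obtain L where L: "L-lipschitz_on S g" using assms by blast
  have "bounded (g ` S)"
    using assms(1) L
    by (auto intro!: compact_imp_bounded compact_continuous_image lipschitz_on_continuous_on)
  then obtain b where "\<And>p. p \<in> g ` S \<Longrightarrow> \<bar>p\<bar> \<le> b"
    by (auto simp: bounded_iff)
  then have b: "g ` S \<subseteq> {- b..b}"
    by (meson abs_le_iff atLeastAtMost_iff minus_le_iff subsetI)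
  have "bounded (h' ` {- b..b})"
    using continuous_on_subset[OF assms(4)] by (intro compact_imp_bounded compact_continuous_image) auto
  then obtain B where B: "0 < B" "\<And>x. x \<in> {- b..b} \<Longrightarrow> \<bar>h' x\<bar> \<le> B"
    by (auto simp: bounded_pos)
  have "B-lipschitz_on (g ` S) h"
  proof (rule lipschitz_onI)
    fix p q assume "p \<in> g ` S" "q \<in> g ` S"
    then have "p \<in> {- b..b}" "q \<in> {- b..b}" using b by auto
    moreover have "(h has_field_derivative h' y) (at y within {- b..b})" for y
      using assms(3) by (rule has_field_derivative_at_within)
    ultimately show "dist (h p) (h q) \<le> B * dist p q"
      using field_differentiable_bound[of "{- b..b}" h h' B p q] B(2) by (simp add: dist_norm)
  qed (use B in auto)
  then show ?thesis using lipschitz_on_compose2[OF L] by blast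
qed

lemma closed_loop_lipschitz_compact:
  assumes "smooth_fun \<phi>" and "compact S"
  shows "\<exists>L. L-lipschitz_on S (closed_loop \<theta> \<phi> \<Gamma> \<epsilon> c a)"
proof -
  have "\<phi> field_differentiable at y" "deriv \<phi> field_differentiable at y" for y
    using assms(1)[unfolded smooth_fun_def, rule_format, of 0 y]
      assms(1)[unfolded smooth_fun_def, rule_format, of 1 y] by auto
  then have \<phi>: "(\<phi> has_real_derivative deriv \<phi> y) (at y)" "continuous_on UNIV (deriv \<phi>)" for y
    by (auto simp: DERIV_deriv_iff_field_differentiable
        intro: continuous_at_imp_continuous_on field_differentiable_imp_continuous_at)
  have fst: "\<exists>L. L-lipschitz_on S fst" and snd: "\<exists>L. L-lipschitz_on S snd" for S :: "(real \<times> real) set"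
    using dist_fst_le dist_snd_le by (auto intro!: exI[of _ 1] lipschitz_onI)
  have const: "\<exists>L. L-lipschitz_on S (\<lambda>_. k)" for k :: real
    by (rule exI[of _ 0]) (auto intro: lipschitz_onI)
  have max: "\<exists>L. L-lipschitz_on S (\<lambda>p. max 0 (h p))" if "\<exists>L. L-lipschitz_on S h" for h :: "real \<times> real \<Rightarrow> real"
  proof -
    have "1-lipschitz_on T (max (0::real))" for T
      by (rule lipschitz_onI) (auto simp: dist_real_def max_def)
    then show ?thesis using that lipschitz_on_compose2 by blast
  qed
  have exp: "\<exists>L. L-lipschitz_on S (\<lambda>p. exp (h p))" if "\<exists>L. L-lipschitz_on S h" for h :: "real \<times> real \<Rightarrow> real"
    by (rule lipschitz_compact_C1[OF assms(2) that DERIV_exp]) (intro continuous_intros)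
  note intros = lipschitz_compact_mult[OF assms(2)] lipschitz_ex_add const exp max fst snd
    lipschitz_compact_C1[OF assms(2) fst \<phi>]
  \<comment> \<open>Differences, squares and divisions by constants are written as sums and products
    so that \<open>intros\<close> applies.\<close>
  have "\<exists>L. L-lipschitz_on S (\<lambda>p. \<theta> * fst p * \<phi> (fst p) + (- 1) * (c / 2) * fst p
      + (- 1 / 2) * (1 + exp (snd p)) * ((1 + \<phi> (fst p) * \<phi> (fst p) * (fst p * fst p)) * (1 / (2 * a))
        + c + \<phi> (fst p) * \<phi> (fst p) * (1 / c)) * fst p)"
    by (intro intros)
  moreover have "\<exists>L. L-lipschitz_on S (\<lambda>p. \<Gamma> * exp (- 1 * snd p) * max 0 (1 / 2 * (fst p * fst p) + (- \<epsilon>)))"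
    by (intro intros)
  ultimately show ?thesis
    using lipschitz_on_Pair unfolding closed_loop_def
    by (fastforce simp: case_prod_beta power2_eq_square)
qed

subsection \<open>Invariant sublevel sets\<close>

lemma increment_le_within:
  fixes f :: "real \<Rightarrow> real"
  assumes "a \<le> b" and "\<And>t. t \<in> {a..b} \<Longrightarrow> (f has_real_derivative f' t) (at t within {a..b})"
    and "\<And>t. t \<in> {a<..<b} \<Longrightarrow> f' t \<le> C"
  shows "f b - f a \<le> C * (b - a)"
proof (cases "a < b")
  case True
  then obtain t where "t \<in> {a<..<b}" "f b - f a = f' t * (b - a)"
    using mvt_simple[of a b f "\<lambda>t. (*) (f' t)"] assms(2)
    by (auto simp: has_field_derivative_def)
  then show ?thesis
    using assms(3)[of t] True by simp
qed (use assms(1) in auto)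

text \<open>To leave the sublevel set, \<open>v\<close> must climb through the band above
  \<open>k\<close>. Between the last time \<open>p\<close> below the band and the next time
  \<open>q\<close> at level \<open>l\<close>, the derivative is nonpositive, which forbids the
  climb.\<close>

lemma sublevel_invariant:
  fixes v :: "real \<Rightarrow> real"
  assumes "s \<le> t" and der: "\<And>u. u \<in> {s..t} \<Longrightarrow> (v has_real_derivative v' u) (at u within {s..t})"
    and "k < m" and band: "\<And>u. u \<in> {s..t} \<Longrightarrow> k < v u \<Longrightarrow> v u < m \<Longrightarrow> v' u \<le> 0"
    and "v s \<le> k"
  shows "v t \<le> k"
proof (rule ccontr)
  assume "\<not> v t \<le> k"
  \<comment> \<open>The minimum keeps \<open>l\<close> inside the band and guarantees that it is
    reached by time \<open>t\<close>, even if \<open>v t < m\<close>.\<close>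
  define l where "l = min (v t) m"
  have l: "k < l" "l \<le> m" "l \<le> v t"
    using \<open>k < m\<close> \<open>\<not> v t \<le> k\<close> by (auto simp: l_def)
  have cont: "continuous_on {s..t} v"
    using der by (rule DERIV_continuous_on)
  have "closed {u \<in> {s..t}. v u \<in> {..k}}"
    using cont by (intro continuous_closed_preimage[unfolded vimage_def Int_def mem_Collect_eq]) auto
  then have "compact {u \<in> {s..t}. v u \<le> k}"
    by (auto simp: compact_eq_bounded_closed intro: bounded_subset[OF bounded_closed_interval])
  moreover have "s \<in> {u \<in> {s..t}. v u \<le> k}"
    using assms by auto
  ultimately obtain p where p: "p \<in> {s..t}" "v p \<le> k" "\<And>u. u \<in> {s..t} \<Longrightarrow> v u \<le> k \<Longrightarrow> u \<le> p"
    using compact_attains_sup[of "{u \<in> {s..t}. v u \<le> k}"] by auto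
  have "closed {u \<in> {p..t}. v u \<in> {l..}}"
    using continuous_on_subset[OF cont, of "{p..t}"] p(1)
    by (intro continuous_closed_preimage[unfolded vimage_def Int_def mem_Collect_eq]) auto
  then have "compact {u \<in> {p..t}. l \<le> v u}"
    by (auto simp: compact_eq_bounded_closed intro: bounded_subset[OF bounded_closed_interval])
  moreover have "t \<in> {u \<in> {p..t}. l \<le> v u}"
    using p(1) l by auto
  ultimately obtain q where q: "q \<in> {p..t}" "l \<le> v q" "\<And>u. u \<in> {p..t} \<Longrightarrow> l \<le> v u \<Longrightarrow> q \<le> u"
    using compact_attains_inf[of "{u \<in> {p..t}. l \<le> v u}"] by auto
  have "v q - v p \<le> 0 * (q - p)"
  proof (rule increment_le_within)
    fix u assume "u \<in> {p..q}"
    then show "(v has_real_derivative v' u) (at u within {p..q})"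
      using p(1) q(1) by (intro DERIV_subset[OF der]) auto
  next
    fix u assume "u \<in> {p<..<q}"
    then have "u \<in> {s..t}" "\<not> v u \<le> k" "\<not> l \<le> v u"
      using p(1) q(1) p(3)[of u] q(3)[of u] by auto
    then show "v' u \<le> 0"
      using l(2) by (intro band) auto
  qed (use q in auto)
  then show False
    using p q l by simp
qed

subsection \<open>A priori bounds for the adaptive loop\<close>

locale adaptive_loop =
  fixes \<Gamma> \<epsilon> c a \<theta> r :: real and \<phi> :: "real \<Rightarrow> real"
  assumes pos: "0 < \<Gamma>" "0 < \<epsilon>" "0 < c" "0 < a" "0 < r"
    and band: "\<And>y. y\<^sup>2 / 2 \<in> {\<epsilon>..\<epsilon> + r} \<Longrightarrow>
      \<theta> * \<phi> y \<le> c + (1 + (\<phi> y)\<^sup>2 * y\<^sup>2) / (4 * a) + (\<phi> y)\<^sup>2 / (2 * c)"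
begin

text \<open>The feedback is \<open>- c / 2 * y - (1 + exp z) * gain y * y\<close>.\<close>

definition gain :: "real \<Rightarrow> real" where
  "gain y = ((1 + (\<phi> y)\<^sup>2 * y\<^sup>2) / (2 * a) + c + (\<phi> y)\<^sup>2 / c) / 2"

text \<open>The derivative of \<open>y\<^sup>2 / 2\<close> along the flow at \<open>(y, ln w)\<close> is \<open>y\<^sup>2 * rate y w\<close>.\<close>

definition rate :: "real \<Rightarrow> real \<Rightarrow> real" where
  "rate y w = \<theta> * \<phi> y - c / 2 - (1 + w) * gain y"

lemma closed_loop_eq:
  "closed_loop \<theta> \<phi> \<Gamma> \<epsilon> c a (y, z) = (y * rate y (exp z), \<Gamma> * exp (- z) * max 0 (y\<^sup>2 / 2 - \<epsilon>))"
proof -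
  have "\<theta> * y * p - c / 2 * y - E / 2 * B * y = y * (\<theta> * p - c / 2 - E * (B / 2))" for p E B
    by (simp add: algebra_simps)
  then show ?thesis
    unfolding closed_loop_def rate_def gain_def prod.case by simp
qed

lemma gain_eq: "gain y = (1 + (\<phi> y)\<^sup>2 * y\<^sup>2) / (4 * a) + c / 2 + (\<phi> y)\<^sup>2 / (2 * c)"
  by (simp add: gain_def add_divide_distrib)

lemma gain_ge: "c / 2 + (\<phi> y)\<^sup>2 / (2 * c) \<le> gain y"
proof -
  have "0 \<le> (1 + (\<phi> y)\<^sup>2 * y\<^sup>2) / (4 * a)"
    using pos by (intro divide_nonneg_pos) auto
  then show ?thesis unfolding gain_eq by linarith
qed

lemma half_c_le_gain: "c / 2 \<le> gain y"
proof -
  have "0 \<le> (\<phi> y)\<^sup>2 / (2 * c)" using pos by simp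
  then show ?thesis using gain_ge[of y] by linarith
qed

lemma rate_eq: "rate y w = \<theta> * \<phi> y - c / 2 - gain y - gain y * w"
  by (simp add: rate_def algebra_simps)

text \<open>Young's inequality, from a completed square: the term
  \<open>(\<phi> y)\<^sup>2 / (2 * c)\<close> is absorbed by the gain, and what remains of the gain
  is at least \<open>c / 2\<close>.\<close>

lemma rate_le:
  assumes "0 \<le> w"
  shows "rate y w \<le> c / 2 * (\<theta>\<^sup>2 - 2 - w)"
proof -
  have "0 \<le> (\<phi> y - c * \<theta>)\<^sup>2 / (2 * c)"
    using pos by simp
  also have "\<dots> = (\<phi> y)\<^sup>2 / (2 * c) + c / 2 * \<theta>\<^sup>2 - \<theta> * \<phi> y"
    using pos by (simp add: power2_eq_square field_simps)
  finally have "\<theta> * \<phi> y \<le> (\<phi> y)\<^sup>2 / (2 * c) + c / 2 * \<theta>\<^sup>2" by simp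
  moreover have "c / 2 * w \<le> gain y * w"
    using assms by (intro mult_right_mono half_c_le_gain)
  moreover have "c / 2 * (\<theta>\<^sup>2 - 2 - w) = c / 2 * \<theta>\<^sup>2 - c - c / 2 * w"
    by (simp add: field_simps)
  ultimately show ?thesis
    using gain_ge[of y] unfolding rate_eq by linarith
qed

text \<open>The band condition says exactly \<open>\<theta> * \<phi> y \<le> c / 2 + gain y\<close>,
  so only the adaptive damping \<open>gain y * w\<close> survives.\<close>

lemma rate_le_band:
  assumes "0 \<le> w" and "y\<^sup>2 / 2 \<in> {\<epsilon>..\<epsilon> + r}"
  shows "rate y w \<le> - (c / 2 * w)"
proof -
  have "c / 2 * w \<le> gain y * w"
    using assms by (intro mult_right_mono half_c_le_gain)
  moreover have "\<theta> * \<phi> y \<le> c / 2 + gain y"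
    using band[OF assms(2)] unfolding gain_eq by linarith
  ultimately show ?thesis
    unfolding rate_eq by linarith
qed

text \<open>A bound for \<open>y\<^sup>2 / 2\<close>, the time needed to reach \<open>y\<^sup>2 / 2 \<le> \<epsilon>\<close>, and a bound for
  \<open>exp z\<close>, along trajectories starting in the ball of radius \<open>R\<close>. The first summand of
  \<open>hit_time\<close> is the time after which \<open>exp z \<ge> \<theta>\<^sup>2 + 1\<close>, unless \<open>y\<^sup>2 / 2 \<le> \<epsilon> + r / 2\<close> has
  occurred before.\<close>

definition energy_bound :: "real \<Rightarrow> real" where
  "energy_bound R = \<epsilon> + R\<^sup>2 / 2 + c * (\<epsilon> + r) / (r * \<Gamma>) * exp (\<theta>\<^sup>2)"

definition hit_time :: "real \<Rightarrow> real" where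
  "hit_time R = 2 * (\<theta>\<^sup>2 + 1) / (\<Gamma> * r) + energy_bound R / (c * \<epsilon> * exp (- \<bar>R\<bar>))"

definition weight_bound :: "real \<Rightarrow> real" where
  "weight_bound R = exp \<bar>R\<bar> + \<Gamma> * energy_bound R * hit_time R"

lemma energy_bound_pos: "0 < energy_bound R"
  using pos by (auto simp: energy_bound_def intro!: add_pos_nonneg)

lemma eps_le_energy_bound: "\<epsilon> \<le> energy_bound R"
  using pos by (auto simp: energy_bound_def intro!: add_increasing2)

lemma hit_time_pos: "0 < hit_time R"
  using pos energy_bound_pos[of R]
  by (auto simp: hit_time_def intro!: add_nonneg_pos divide_nonneg_pos)

end

text \<open>A compact time interval serves both the local trajectories of the existence proof and
  restrictions of global ones. All bounds derived here depend on the initial state only through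
  \<open>R\<close>.\<close>

locale adaptive_loop_trajectory = adaptive_loop +
  fixes x :: "real \<Rightarrow> real \<times> real" and \<tau> R :: real
  assumes trajectory: "\<And>t. t \<in> {0..\<tau>} \<Longrightarrow>
      (x has_vector_derivative closed_loop \<theta> \<phi> \<Gamma> \<epsilon> c a (x t)) (at t within {0..\<tau>})"
    and initial: "norm (x 0) \<le> R"
begin

definition V :: "real \<Rightarrow> real" where "V t = (fst (x t))\<^sup>2 / 2"
definition w :: "real \<Rightarrow> real" where "w t = exp (snd (x t))"
definition V' :: "real \<Rightarrow> real" where "V' t = 2 * V t * rate (fst (x t)) (w t)"
definition w' :: "real \<Rightarrow> real" where "w' t = \<Gamma> * max 0 (V t - \<epsilon>)"

lemma V_nonneg: "0 \<le> V t" and w_pos: "0 < w t"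
  by (simp_all add: V_def w_def)

lemma has_derivative_fst_x:
  assumes "t \<in> {0..\<tau>}"
  shows "((\<lambda>t. fst (x t)) has_real_derivative fst (x t) * rate (fst (x t)) (w t)) (at t within {0..\<tau>})"
  using bounded_linear.has_vector_derivative[OF bounded_linear_fst trajectory[OF assms]]
  by (cases "x t") (simp add: closed_loop_eq w_def has_real_derivative_iff_has_vector_derivative)

lemma has_derivative_snd_x:
  assumes "t \<in> {0..\<tau>}"
  shows "((\<lambda>t. snd (x t)) has_real_derivative \<Gamma> * exp (- snd (x t)) * max 0 (V t - \<epsilon>)) (at t within {0..\<tau>})"
  using bounded_linear.has_vector_derivative[OF bounded_linear_snd trajectory[OF assms]]
  by (cases "x t") (simp add: closed_loop_eq V_def has_real_derivative_iff_has_vector_derivative)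

lemma has_derivative_V:
  assumes "{s..t} \<subseteq> {0..\<tau>}" and "u \<in> {s..t}"
  shows "(V has_real_derivative V' u) (at u within {s..t})"
proof (rule DERIV_subset[OF _ assms(1)])
  show "(V has_real_derivative V' u) (at u within {0..\<tau>})"
    unfolding V_def[abs_def] using assms
    by (auto intro!: derivative_eq_intros has_derivative_fst_x simp: V'_def V_def power2_eq_square)
qed

text \<open>The factor \<open>exp (- z)\<close> in the adaptation law cancels against the derivative
  of \<open>exp z\<close>.\<close>

lemma has_derivative_w:
  assumes "{s..t} \<subseteq> {0..\<tau>}" and "u \<in> {s..t}"
  shows "(w has_real_derivative w' u) (at u within {s..t})"
proof (rule DERIV_subset[OF _ assms(1)])
  show "(w has_real_derivative w' u) (at u within {0..\<tau>})"
    unfolding w_def[abs_def] using assms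
    by (auto intro!: derivative_eq_intros has_derivative_snd_x simp: w'_def exp_minus field_simps)
qed

lemma V'_le: "V' t \<le> c * (\<theta>\<^sup>2 - 2 - w t) * V t"
  using mult_left_mono[OF rate_le[OF less_imp_le[OF w_pos]], of "2 * V t" "fst (x t)" t] V_nonneg[of t]
  by (simp add: V'_def algebra_simps)

lemma V'_le_band: "V t \<in> {\<epsilon>..\<epsilon> + r} \<Longrightarrow> V' t \<le> - (c * w t * V t)"
  using mult_left_mono[OF rate_le_band[OF less_imp_le[OF w_pos]], of "fst (x t)" "2 * V t" t] V_nonneg[of t]
  by (simp add: V'_def algebra_simps V_def)

lemma V'_nonpos_band: "V t \<in> {\<epsilon>..\<epsilon> + r} \<Longrightarrow> V' t \<le> 0"
  using V'_le_band[of t] pos V_nonneg[of t] w_pos[of t]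
  by (smt (verit) mult_nonneg_nonneg)

lemma w_mono:
  assumes "0 \<le> s" "s \<le> t" "t \<le> \<tau>"
  shows "w s \<le> w t"
proof -
  have "((\<lambda>u. - w u) t) - ((\<lambda>u. - w u) s) \<le> 0 * (t - s)"
    using assms pos by (intro increment_le_within[where f' = "\<lambda>u. - w' u"])
      (auto intro!: DERIV_minus has_derivative_w, auto simp: w'_def)
  then show ?thesis by simp
qed

text \<open>Also used backwards: if \<open>V\<close> exceeds such a level now, it exceeded it at all
  earlier times.\<close>

lemma sublevel_V:
  assumes "0 \<le> s" "s \<le> t" "t \<le> \<tau>" and "\<epsilon> \<le> k" "k < \<epsilon> + r" and "V s \<le> k"
  shows "V t \<le> k"
  by (rule sublevel_invariant[of s t V V' k "\<epsilon> + r"])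
    (use assms V'_nonpos_band in \<open>auto intro!: has_derivative_V\<close>)

lemma initial_bounds: "V 0 \<le> R\<^sup>2 / 2" "exp (- \<bar>R\<bar>) \<le> w 0" "w 0 \<le> exp \<bar>R\<bar>"
proof -
  have "\<bar>fst (x 0)\<bar> \<le> R" "\<bar>snd (x 0)\<bar> \<le> R"
    using norm_fst_le[of "fst (x 0)" "snd (x 0)"] norm_snd_le[of "snd (x 0)" "fst (x 0)"] initial by auto
  then show "V 0 \<le> R\<^sup>2 / 2" "exp (- \<bar>R\<bar>) \<le> w 0" "w 0 \<le> exp \<bar>R\<bar>"
    by (auto simp: V_def w_def abs_le_square_iff intro: power2_le_iff_abs_le[THEN iffD2])
qed

text \<open>While \<open>V > \<epsilon>\<close>, growth of \<open>V\<close> is paid for by growth of \<open>w\<close>: the function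
  \<open>V + K * exp (\<theta>\<^sup>2 - w)\<close> is nonincreasing.\<close>

lemma V_le_energy_bound:
  assumes "t \<in> {0..\<tau>}"
  shows "V t \<le> energy_bound R"
proof (cases "V t \<le> \<epsilon>")
  case True
  then show ?thesis
    using eps_le_energy_bound[of R] by simp
next
  case False
  \<comment> \<open>Above \<open>\<epsilon> + r\<close> the ratio of \<open>V\<close> to
    \<open>V - \<epsilon>\<close> is at most \<open>(\<epsilon> + r) / r\<close>; hence
    \<open>K * w'\<close> dominates \<open>c * V\<close> there.\<close>
  define K where "K = c * (\<epsilon> + r) / (r * \<Gamma>)"
  have K: "0 < K" using pos by (simp add: K_def)
  have large: "\<epsilon> < V s" if "s \<in> {0..t}" for s
    using sublevel_V[of s t \<epsilon>] that False assms pos by force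
  have "(V t + K * exp (\<theta>\<^sup>2 - w t)) - (V 0 + K * exp (\<theta>\<^sup>2 - w 0)) \<le> 0 * (t - 0)"
  proof (rule increment_le_within)
    fix s assume "s \<in> {0..t}"
    then show "((\<lambda>s. V s + K * exp (\<theta>\<^sup>2 - w s)) has_real_derivative
        V' s - K * (exp (\<theta>\<^sup>2 - w s) * w' s)) (at s within {0..t})"
      using assms by (auto intro!: derivative_eq_intros has_derivative_V has_derivative_w)
  next
    fix s assume s: "s \<in> {0<..<t}"
    define e where "e = exp (\<theta>\<^sup>2 - w s)"
    \<comment> \<open>The exponential dominates \<open>\<theta>\<^sup>2 - 2 - w s\<close> whatever
      its sign.\<close>
    have e: "0 < e" "\<theta>\<^sup>2 - 2 - w s \<le> e"
      using exp_ge_add_one_self[of "\<theta>\<^sup>2 - w s"] unfolding e_def by (simp, linarith)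
    have w': "w' s = \<Gamma> * (V s - \<epsilon>)"
      using large[of s] s by (simp add: w'_def)
    have "V' s \<le> K * (e * w' s)"
    proof (cases "V s \<le> \<epsilon> + r")
      case True
      have "V' s \<le> 0" using V'_nonpos_band True large[of s] s by simp
      also have "0 \<le> K * (e * w' s)"
        using K e pos large[of s] s by (simp add: w')
      finally show ?thesis .
    next
      case False
      have "V' s \<le> c * (\<theta>\<^sup>2 - 2 - w s) * V s" by (rule V'_le)
      also have "\<dots> \<le> c * e * V s"
        using e pos V_nonneg by (intro mult_right_mono mult_left_mono) auto
      also have "V s \<le> (\<epsilon> + r) / r * (V s - \<epsilon>)"
      proof -
        have "0 \<le> \<epsilon> * (V s - (\<epsilon> + r))"
          using False pos by simp
        then show ?thesis using pos by (simp add: field_simps)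
      qed
      then have "c * e * V s \<le> c * e * ((\<epsilon> + r) / r * (V s - \<epsilon>))"
        using pos e by (intro mult_left_mono) auto
      also have "\<dots> = K * (e * w' s)"
        using pos by (simp add: w' K_def)
      finally show ?thesis .
    qed
    then show "V' s - K * (exp (\<theta>\<^sup>2 - w s) * w' s) \<le> 0" by (simp add: e_def)
  qed (use assms in auto)
  moreover have "K * exp (\<theta>\<^sup>2 - w 0) \<le> K * exp (\<theta>\<^sup>2)"
    using K w_pos[of 0] by simp
  moreover have "0 \<le> K * exp (\<theta>\<^sup>2 - w t)" using K by simp
  ultimately show ?thesis
    using initial_bounds(1) pos(2) unfolding energy_bound_def K_def[symmetric] by linarith
qed

text \<open>If \<open>V t > \<epsilon>\<close>, then \<open>V > \<epsilon>\<close> on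
  \<open>{0..t}\<close>, and after \<open>T1\<close> it decreases at least at rate
  \<open>\<kappa>\<close>. By \<open>hit_time R\<close> this would use up the whole of
  \<open>energy_bound R\<close>.\<close>

lemma V_le_hit_time:
  assumes "t \<in> {hit_time R..\<tau>}"
  shows "V t \<le> \<epsilon>"
proof (rule ccontr)
  assume not_le: "\<not> V t \<le> \<epsilon>"
  \<comment> \<open>The smaller of two decay rates:
    \<open>c * \<epsilon> * exp (- \<bar>R\<bar>)\<close> near \<open>\<epsilon>\<close>, where
    \<open>w\<close> is only known to exceed its initial value, and \<open>c * \<epsilon>\<close>
    higher up, where \<open>w\<close> has already grown.\<close>
  define \<kappa> where "\<kappa> = c * \<epsilon> * exp (- \<bar>R\<bar>)"
  define T1 where "T1 = 2 * (\<theta>\<^sup>2 + 1) / (\<Gamma> * r)"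
  have \<kappa>: "0 < \<kappa>" "\<kappa> \<le> c * \<epsilon>" using pos by (auto simp: \<kappa>_def)
  have t: "T1 + energy_bound R / \<kappa> \<le> t"
    using assms by (simp add: hit_time_def T1_def \<kappa>_def)
  have T1: "0 < T1" "T1 \<le> t"
  proof -
    show "0 < T1" using pos by (auto simp: T1_def intro!: divide_pos_pos add_nonneg_pos)
    have "0 \<le> energy_bound R / \<kappa>" using energy_bound_pos[of R] \<kappa> by simp
    then show "T1 \<le> t" using t by simp
  qed
  have large: "\<epsilon> < V s" if "s \<in> {0..t}" for s
    using sublevel_V[of s t \<epsilon>] that not_le assms pos by force
  have "V t - V T1 \<le> - \<kappa> * (t - T1)"
  proof (rule increment_le_within)
    fix s assume "s \<in> {T1..t}"
    then show "(V has_real_derivative V' s) (at s within {T1..t})"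
      using assms T1 by (intro has_derivative_V) auto
  next
    fix s assume s: "s \<in> {T1<..<t}"
    show "V' s \<le> - \<kappa>"
    proof (cases "V s \<le> \<epsilon> + r / 2")
      case True
      have "exp (- \<bar>R\<bar>) \<le> w s"
        using initial_bounds(2) w_mono[of 0 s] s assms T1 by simp
      then have "\<epsilon> * exp (- \<bar>R\<bar>) \<le> V s * w s"
        using large[of s] s T1 pos by (intro mult_mono) auto
      then have "\<kappa> \<le> c * w s * V s"
        using pos by (simp add: \<kappa>_def algebra_simps)
      then show ?thesis
        using V'_le_band[of s] True large[of s] s T1 pos by simp
    next
      case False
      have high: "\<epsilon> + r / 2 < V u" if "u \<in> {0..s}" for u
        using sublevel_V[of u s "\<epsilon> + r / 2"] that False s assms pos by force
      have "(\<lambda>u. - w u) s - (\<lambda>u. - w u) 0 \<le> - (\<Gamma> * r / 2) * (s - 0)"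
      proof (rule increment_le_within[where f' = "\<lambda>u. - w' u"])
        fix u assume "u \<in> {0<..<s}"
        then have "r / 2 \<le> max 0 (V u - \<epsilon>)" using high[of u] by (intro max.coboundedI2) simp
        then have "\<Gamma> * (r / 2) \<le> w' u"
          unfolding w'_def by (rule mult_left_mono[OF _ less_imp_le[OF pos(1)]])
        then show "- w' u \<le> - (\<Gamma> * r / 2)" by simp
      qed (use s T1 assms in \<open>auto intro!: DERIV_minus has_derivative_w\<close>)
      moreover have "\<Gamma> * r / 2 * T1 \<le> \<Gamma> * r / 2 * s"
        using s pos by (intro mult_left_mono) auto
      moreover have "\<Gamma> * r / 2 * T1 = \<theta>\<^sup>2 + 1"
        using pos by (simp add: T1_def)
      ultimately have "\<theta>\<^sup>2 + 1 \<le> w s"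
        using w_pos[of 0] by simp
      then have "c * (\<theta>\<^sup>2 - 2 - w s) * V s \<le> c * (- 1) * V s"
        using pos V_nonneg by (intro mult_right_mono mult_left_mono) auto
      also have "\<dots> \<le> - (c * \<epsilon>)"
        using large[of s] s T1 pos by simp
      finally show ?thesis
        using V'_le[of s] \<kappa> by simp
    qed
  qed (use T1 in auto)
  moreover have "energy_bound R \<le> \<kappa> * (t - T1)"
    using t \<kappa>(1) by (simp add: field_simps)
  moreover have "V T1 \<le> energy_bound R"
    using T1 assms by (intro V_le_energy_bound) auto
  ultimately show False
    using not_le pos by simp
qed

text \<open>Adaptation proceeds at a bounded rate up to \<open>hit_time R\<close> and stops
  afterwards, since then \<open>V \<le> \<epsilon>\<close>.\<close>

lemma w_le_weight_bound:
  assumes "t \<in> {0..\<tau>}"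
  shows "w t \<le> weight_bound R"
proof -
  define s where "s = min t (hit_time R)"
  have s: "0 \<le> s" "s \<le> t" "s \<le> hit_time R"
    using assms hit_time_pos[of R] by (auto simp: s_def)
  have "w s - w 0 \<le> \<Gamma> * energy_bound R * (s - 0)"
  proof (rule increment_le_within)
    fix u assume "u \<in> {0<..<s}"
    then have "max 0 (V u - \<epsilon>) \<le> energy_bound R"
      using V_le_energy_bound[of u] energy_bound_pos[of R] s assms pos by auto
    then show "w' u \<le> \<Gamma> * energy_bound R"
      unfolding w'_def using pos by simp
  qed (use s assms in \<open>auto intro!: has_derivative_w\<close>)
  also have "\<dots> \<le> \<Gamma> * energy_bound R * hit_time R"
    using pos energy_bound_pos[of R] s by simp
  finally have "w s \<le> weight_bound R"
    using initial_bounds(3) by (simp add: weight_bound_def)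
  moreover have "w t - w s \<le> 0 * (t - s)"
  proof (rule increment_le_within)
    fix u assume "u \<in> {s<..<t}"
    \<comment> \<open>If \<open>t\<close> comes before the hitting time, then \<open>s = t\<close>
      and there is no such \<open>u\<close>.\<close>
    then have "u \<in> {hit_time R..\<tau>}" using assms by (auto simp: s_def)
    then show "w' u \<le> 0" using V_le_hit_time[of u] by (simp add: w'_def)
  qed (use s assms in \<open>auto intro!: has_derivative_w\<close>)
  ultimately show ?thesis by simp
qed

end

subsection \<open>Stability\<close>

lemma (in adaptive_loop) trajectory_of_forward_solution:
  assumes "forward_solution (closed_loop \<theta> \<phi> \<Gamma> \<epsilon> c a) x0 x" and "norm x0 \<le> R"
  shows "adaptive_loop_trajectory \<Gamma> \<epsilon> c a \<theta> r \<phi> x \<tau> R"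
proof unfold_locales
  fix t assume "t \<in> {0..\<tau>}"
  then show "(x has_vector_derivative closed_loop \<theta> \<phi> \<Gamma> \<epsilon> c a (x t)) (at t within {0..\<tau>})"
    using assms(1) unfolding forward_solution_def
    by (auto intro: has_vector_derivative_within_subset)
qed (use assms in \<open>auto simp: forward_solution_def\<close>)

lemma norm_deadzone_output_le:
  assumes "(fst p)\<^sup>2 / 2 \<le> k" and "\<epsilon> \<le> k"
  shows "norm (deadzone_output \<epsilon> p) \<le> sqrt (2 * k) - sqrt (2 * \<epsilon>)"
proof -
  have "\<bar>fst p\<bar> \<le> sqrt (2 * k)"
    using assms(1) by (intro real_le_rsqrt) simp
  then show ?thesis
    using assms(2) by (simp add: deadzone_output_def case_prod_beta)
qed

lemma (in adaptive_loop) forward_complete: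
  assumes "smooth_fun \<phi>"
  shows "forward_complete (closed_loop \<theta> \<phi> \<Gamma> \<epsilon> c a)"
  unfolding forward_complete_def
proof
  fix x0 :: "real \<times> real"
  define R where "R = norm x0"
  \<comment> \<open>The rectangle exceeds the a priori bounds; \<open>norm x0\<close> accommodates
    the initial state and, in \<open>Z\<close>, the lower bound for \<open>z\<close>, while
    \<open>1\<close> makes the inclusions strict.\<close>
  define Y where "Y = sqrt (2 * energy_bound R) + norm x0 + 1"
  define Z where "Z = \<bar>ln (weight_bound R)\<bar> + norm x0 + 1"
  let ?K = "{- Y..Y} \<times> {- Z..Z}"
  have interior: "p \<in> interior ?K \<longleftrightarrow> \<bar>fst p\<bar> < Y \<and> \<bar>snd p\<bar> < Z" for p
    by (cases p) (auto simp: interior_Times)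
  have K: "compact ?K" "convex ?K"
    by (simp_all add: compact_Times convex_Times)
  obtain L where "L-lipschitz_on ?K (closed_loop \<theta> \<phi> \<Gamma> \<epsilon> c a)"
    using closed_loop_lipschitz_compact[OF assms K(1)] by blast
  then show "\<exists>x. forward_solution (closed_loop \<theta> \<phi> \<Gamma> \<epsilon> c a) x0 x"
  proof (rule forward_solution_exists_confined)
    have "0 \<le> sqrt (2 * energy_bound R)"
      using energy_bound_pos[of R] by simp
    moreover have "\<bar>fst x0\<bar> \<le> norm x0" "\<bar>snd x0\<bar> \<le> norm x0"
      using norm_fst_le[of "fst x0" "snd x0"] norm_snd_le[of "snd x0" "fst x0"] by simp_all
    ultimately show "x0 \<in> interior ?K"
      unfolding interior unfolding Y_def Z_def by linarith
  next
    fix x \<tau>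
    assume \<tau>: "0 \<le> \<tau>" and x: "x 0 = x0"
      "\<And>t. t \<in> {0..\<tau>} \<Longrightarrow> (x has_vector_derivative closed_loop \<theta> \<phi> \<Gamma> \<epsilon> c a (x t)) (at t within {0..\<tau>})"
    interpret adaptive_loop_trajectory \<Gamma> \<epsilon> c a \<theta> r \<phi> x \<tau> R
      by unfold_locales (use x in \<open>auto simp: R_def\<close>)
    have "\<bar>fst (x \<tau>)\<bar> \<le> sqrt (2 * energy_bound R)"
      using V_le_energy_bound[of \<tau>] \<tau> by (intro real_le_rsqrt) (simp add: V_def)
    moreover have "exp (- R) \<le> w \<tau>"
      using initial_bounds(2) w_mono[of 0 \<tau>] \<tau> by (simp add: R_def)
    then have "- norm x0 \<le> snd (x \<tau>)" by (simp add: w_def R_def)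
    moreover have "snd (x \<tau>) \<le> ln (weight_bound R)"
      using w_le_weight_bound[of \<tau>] \<tau> ln_mono[of "w \<tau>" "weight_bound R"] w_pos[of \<tau>] by (simp add: w_def)
    ultimately show "x \<tau> \<in> interior ?K"
      unfolding interior unfolding Y_def Z_def by (smt (verit) norm_ge_zero)
  qed (rule K)+
qed

lemma (in adaptive_loop) UGAOS:
  assumes "smooth_fun \<phi>"
  shows "UGAOS (closed_loop \<theta> \<phi> \<Gamma> \<epsilon> c a) (deadzone_output \<epsilon>)"
proof -
  let ?f = "closed_loop \<theta> \<phi> \<Gamma> \<epsilon> c a"
  have "lagrange_output_stable ?f (deadzone_output \<epsilon>)"
    unfolding lagrange_output_stable_def
  proof (intro allI impI exI conjI)
    fix \<delta> x0 x and t :: real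
    assume "norm x0 \<le> \<delta>" and "forward_solution ?f x0 x" and t: "0 \<le> t"
    then interpret adaptive_loop_trajectory \<Gamma> \<epsilon> c a \<theta> r \<phi> x t \<delta>
      by (intro trajectory_of_forward_solution)
    show "norm (deadzone_output \<epsilon> (x t)) \<le> sqrt (2 * energy_bound \<delta>)"
      using norm_deadzone_output_le[of "x t" "energy_bound \<delta>" \<epsilon>] V_le_energy_bound[of t] t pos eps_le_energy_bound
      by (simp add: V_def) (smt (verit) real_sqrt_ge_zero)
  qed (use energy_bound_pos in simp)
  moreover have "lyapunov_output_stable ?f (deadzone_output \<epsilon>)"
    unfolding lyapunov_output_stable_def
  proof (intro allI impI exI conjI)
    fix \<eta> t :: real and x0 x
    \<comment> \<open>The radius is independent of \<open>\<eta>\<close>: this ball lies in the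
      invariant set \<open>V \<le> \<epsilon>\<close>, where the output is zero.\<close>
    assume "0 < \<eta>" and "norm x0 \<le> sqrt (2 * \<epsilon>)" and "forward_solution ?f x0 x" and t: "0 \<le> t"
    then interpret adaptive_loop_trajectory \<Gamma> \<epsilon> c a \<theta> r \<phi> x t "sqrt (2 * \<epsilon>)"
      by (intro trajectory_of_forward_solution)
    have "V t \<le> \<epsilon>"
      using sublevel_V[of 0 t \<epsilon>] initial_bounds(1) t pos by simp
    then show "norm (deadzone_output \<epsilon> (x t)) \<le> \<eta>"
      using norm_deadzone_output_le[of "x t" \<epsilon> \<epsilon>] \<open>0 < \<eta>\<close> by (simp add: V_def)
  qed (use pos in simp)
  moreover have "uniformly_globally_output_attractive ?f (deadzone_output \<epsilon>)"
    unfolding uniformly_globally_output_attractive_def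
  proof (intro allI impI exI conjI)
    fix \<eta> R t :: real and x0 x
    \<comment> \<open>The time is independent of \<open>\<eta>\<close> as well, because the output
      vanishes from \<open>hit_time R\<close> on.\<close>
    assume "0 < \<eta>" and "norm x0 \<le> R" and "forward_solution ?f x0 x" and t: "hit_time R \<le> t"
    then interpret adaptive_loop_trajectory \<Gamma> \<epsilon> c a \<theta> r \<phi> x t R
      by (intro trajectory_of_forward_solution)
    show "norm (deadzone_output \<epsilon> (x t)) \<le> \<eta>"
      using norm_deadzone_output_le[of "x t" \<epsilon> \<epsilon>] V_le_hit_time[of t] t \<open>0 < \<eta>\<close> by (simp add: V_def)
  qed (rule hit_time_pos)
  ultimately show ?thesis
    using forward_complete[OF assms] by (simp add: UGAOS_def)
qed

theorem proposition7:
  fixes \<Gamma> \<epsilon> c a \<theta> :: real and \<phi> :: "real \<Rightarrow> real"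
  assumes "\<Gamma> > 0" and "\<epsilon> > 0" and "c > 0" and "a > 0"
    and "smooth_fun \<phi>"
    and "\<exists>r>0. \<forall>y. \<bar>y\<bar> \<in> {sqrt (2 * \<epsilon>)..sqrt (2 * (\<epsilon> + r))} \<longrightarrow>
           \<theta> * \<phi> y \<le> c + (1 + (\<phi> y)\<^sup>2 * y\<^sup>2) / (4 * a) + (\<phi> y)\<^sup>2 / (2 * c)"
  shows "UGAOS (closed_loop \<theta> \<phi> \<Gamma> \<epsilon> c a) (deadzone_output \<epsilon>)"
proof -
  obtain r where "r > 0" and r: "\<And>y. \<bar>y\<bar> \<in> {sqrt (2 * \<epsilon>)..sqrt (2 * (\<epsilon> + r))} \<Longrightarrow>
      \<theta> * \<phi> y \<le> c + (1 + (\<phi> y)\<^sup>2 * y\<^sup>2) / (4 * a) + (\<phi> y)\<^sup>2 / (2 * c)"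
    using assms(6) by blast
  interpret adaptive_loop \<Gamma> \<epsilon> c a \<theta> r \<phi>
  proof unfold_locales
    fix y :: real assume "y\<^sup>2 / 2 \<in> {\<epsilon>..\<epsilon> + r}"
    then have "\<bar>y\<bar> \<in> {sqrt (2 * \<epsilon>)..sqrt (2 * (\<epsilon> + r))}"
      by (auto intro: real_le_lsqrt real_le_rsqrt)
    then show "\<theta> * \<phi> y \<le> c + (1 + (\<phi> y)\<^sup>2 * y\<^sup>2) / (4 * a) + (\<phi> y)\<^sup>2 / (2 * c)" by (rule r)
  qed (use assms \<open>r > 0\<close> in auto)
  show ?thesis using assms(5) by (rule UGAOS)
qed

end
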